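(* For integers $L\ge 3$, $s\ge 1$, $r\ge 0$ and $k_1>k_2\ge 1$, the power series \[ H^*_{L,s,r,k_1,k_2}(q):=\frac{q^r(1-q^{k_1})-(1-q^{k_2})}{(q^s;q)_{L+1}} \] is eventually positive.
   Context: $(a;q)_n=(1-a)(1-aq)\cdots(1-aq^{n-1})$, and the quotient is expanded as a formal power series in $q$. A series $\sum_{n\ge 0}a_nq^n\in\mathbb{R}[[q]]$ is called eventually positive if there exists an integer $M\ge 0$ such that $a_n>0$ for all $n>M$. *)

theory Defs
  imports "HOL-Computational_Algebra.Formal_Power_Series"
begin

definition qpochhammer :: "'a::comm_ring_1 \<Rightarrow> 'a \<Rightarrow> nat \<Rightarrow> 'a" where
  "qpochhammer a q n = (\<Prod>i<n. 1 - a * q ^ i)"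

definition eventually_positive :: "real fps \<Rightarrow> bool" where
  "eventually_positive f \<longleftrightarrow> (\<exists>M::nat. \<forall>n>M. fps_nth f n > 0)"

(* For s \<ge> 1 the denominator has constant coefficient 1, hence is a unit, so the
   division is the usual expansion of the quotient as a power series in q. *)
definition Hstar :: "nat \<Rightarrow> nat \<Rightarrow> nat \<Rightarrow> nat \<Rightarrow> nat \<Rightarrow> real fps" where
  "Hstar L s r k1 k2 =
     (fps_X ^ r * (1 - fps_X ^ k1) - (1 - fps_X ^ k2)) / qpochhammer (fps_X ^ s) fps_X (L + 1)"

end

theory Submission
  imports Defs "HOL-Computational_Algebra.Polynomial_FPS"
begin

text \<open>
  For coprime \<open>a\<close> and \<open>b\<close> the only multiple pole of \<open>1 / ((1 - q\<^sup>a) (1 - q\<^sup>b))\<close> is the double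
  pole at \<open>q = 1\<close>, so its coefficients are those of \<open>1 / (a b (1 - q)\<^sup>2)\<close> up to a bounded error.
  For \<open>L = 3\<close> the denominator consists of two such pairs, and the numerator is \<open>1 - q\<close> times a
  polynomial with value \<open>k\<^sub>1 - k\<^sub>2\<close> at \<open>q = 1\<close>. The factor \<open>1 - q\<close> lowers the order of the pole
  at 1 from four to three, while the product of the two error terms is only \<open>O(n)\<close>; hence the
  coefficients grow like a positive multiple of \<open>n\<^sup>2\<close>. Each further factor \<open>1 / (1 - q\<^sup>j)\<close> has
  nonnegative bounded coefficients and constant coefficient 1, and therefore preserves divergence
  of the coefficients to infinity.
\<close>

definition poly_bounded :: "nat \<Rightarrow> real fps \<Rightarrow> bool" where
  "poly_bounded k f \<longleftrightarrow> (\<exists>C\<ge>0. \<forall>n. \<bar>fps_nth f n\<bar> \<le> C * (real n + 1) ^ k)"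

lemma poly_bounded_add:
  assumes "poly_bounded k f" "poly_bounded k g"
  shows "poly_bounded k (f + g)"
proof -
  obtain C D where C: "C \<ge> 0" "\<And>n. \<bar>fps_nth f n\<bar> \<le> C * (real n + 1) ^ k"
    and D: "D \<ge> 0" "\<And>n. \<bar>fps_nth g n\<bar> \<le> D * (real n + 1) ^ k"
    using assms unfolding poly_bounded_def by blast
  have "\<bar>fps_nth (f + g) n\<bar> \<le> (C + D) * (real n + 1) ^ k" for n
    using C(2)[of n] D(2)[of n] by (simp add: distrib_right)
  then show ?thesis
    unfolding poly_bounded_def using C(1) D(1) by (intro exI[of _ "C + D"]) auto
qed

lemma poly_bounded_const_mult:
  assumes "poly_bounded k f"
  shows "poly_bounded k (fps_const c * f)"
proof -
  obtain C where C: "C \<ge> 0" "\<And>n. \<bar>fps_nth f n\<bar> \<le> C * (real n + 1) ^ k"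
    using assms unfolding poly_bounded_def by blast
  have "\<bar>fps_nth (fps_const c * f) n\<bar> \<le> (\<bar>c\<bar> * C) * (real n + 1) ^ k" for n
    using mult_left_mono[OF C(2)[of n], of "\<bar>c\<bar>"] by (simp add: abs_mult mult.assoc)
  then show ?thesis
    unfolding poly_bounded_def using C(1) by (intro exI[of _ "\<bar>c\<bar> * C"]) auto
qed

lemma poly_bounded_diff:
  assumes "poly_bounded k f" "poly_bounded k g"
  shows "poly_bounded k (f - g)"
  using poly_bounded_add[OF assms(1) poly_bounded_const_mult[OF assms(2), of "-1"]]
  by (simp flip: fps_const_neg)

lemma poly_bounded_X_mult:
  assumes "poly_bounded k f"
  shows "poly_bounded k (fps_X * f)"
proof -
  obtain C where C: "C \<ge> 0" "\<And>n. \<bar>fps_nth f n\<bar> \<le> C * (real n + 1) ^ k"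
    using assms unfolding poly_bounded_def by blast
  have "\<bar>fps_nth (fps_X * f) n\<bar> \<le> C * (real n + 1) ^ k" for n
  proof (cases n)
    case 0
    then show ?thesis using C(1) by simp
  next
    case (Suc m)
    have "C * (real m + 1) ^ k \<le> C * (real n + 1) ^ k"
      using C(1) Suc by (intro mult_left_mono power_mono) auto
    then show ?thesis using C(2)[of m] Suc by simp
  qed
  then show ?thesis
    unfolding poly_bounded_def using C(1) by blast
qed

lemma poly_bounded_mult:
  assumes "poly_bounded k f" "poly_bounded l g"
  shows "poly_bounded (k + l + 1) (f * g)"
proof -
  obtain C D where C: "C \<ge> 0" "\<And>n. \<bar>fps_nth f n\<bar> \<le> C * (real n + 1) ^ k"
    and D: "D \<ge> 0" "\<And>n. \<bar>fps_nth g n\<bar> \<le> D * (real n + 1) ^ l"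
    using assms unfolding poly_bounded_def by blast
  have "\<bar>fps_nth (f * g) n\<bar> \<le> (C * D) * (real n + 1) ^ (k + l + 1)" for n
  proof -
    let ?M = "(C * (real n + 1) ^ k) * (D * (real n + 1) ^ l)"
    have f: "\<bar>fps_nth f i\<bar> \<le> C * (real n + 1) ^ k" if "i \<le> n" for i
      using that C(1) by (intro order_trans[OF C(2)] mult_left_mono power_mono) auto
    have g: "\<bar>fps_nth g i\<bar> \<le> D * (real n + 1) ^ l" if "i \<le> n" for i
      using that D(1) by (intro order_trans[OF D(2)] mult_left_mono power_mono) auto
    have "\<bar>fps_nth (f * g) n\<bar> \<le> (\<Sum>i=0..n. \<bar>fps_nth f i * fps_nth g (n - i)\<bar>)"
      unfolding fps_mult_nth by (rule sum_abs)
    also have "\<dots> \<le> (\<Sum>i=0..n. ?M)"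
      unfolding abs_mult using C(1) by (intro sum_mono mult_mono f g) auto
    also have "\<dots> = (C * D) * (real n + 1) ^ (k + l + 1)"
      by (simp add: power_add algebra_simps)
    finally show ?thesis .
  qed
  then show ?thesis
    unfolding poly_bounded_def using C(1) D(1) by (intro exI[of _ "C * D"]) auto
qed

definition geometric_fps :: "nat \<Rightarrow> real fps" where
  "geometric_fps a = inverse (1 - fps_X ^ a)"

lemma one_minus_X_power_mult_geometric_fps:
  assumes "a > 0"
  shows "(1 - fps_X ^ a) * geometric_fps a = 1"
  unfolding geometric_fps_def using assms by (intro inverse_mult_eq_1') simp

lemma one_minus_X_mult_geometric_fps_1: "(1 - fps_X) * geometric_fps 1 = 1"
  using one_minus_X_power_mult_geometric_fps[of 1] by simp

lemma geometric_fps_nth: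
  assumes "a > 0"
  shows "fps_nth (geometric_fps a) n = (if a dvd n then 1 else 0)"
proof -
  let ?f = "Abs_fps (\<lambda>n. if a dvd n then 1 else 0) :: real fps"
  have "(1 - fps_X ^ a) * ?f = 1"
    using assms
    by (intro fps_ext)
      (auto simp: left_diff_distrib fps_X_power_mult_nth dvd_minus_self dest: dvd_imp_le)
  then have "geometric_fps a = ?f"
    unfolding geometric_fps_def by (rule fps_inverse_unique)
  then show ?thesis by simp
qed

lemma poly_bounded_geometric_fps:
  assumes "a > 0"
  shows "poly_bounded 0 (geometric_fps a)"
  unfolding poly_bounded_def using assms by (intro exI[of _ 1]) (simp add: geometric_fps_nth)

lemma poly_bounded_geometric_fps_power:
  assumes "a > 0"
  shows "poly_bounded k (geometric_fps a ^ Suc k)"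
proof (induction k)
  case 0
  show ?case using poly_bounded_geometric_fps[OF assms] by simp
next
  case (Suc k)
  show ?case using poly_bounded_mult[OF poly_bounded_geometric_fps[OF assms] Suc] by simp
qed

lemma geometric_fps_1_power_nth:
  "fps_nth (geometric_fps 1 ^ Suc k) n = real ((n + k) choose k)"
proof -
  have "geometric_fps 1 ^ Suc k = inverse ((1 - fps_const 1 * fps_X) ^ Suc k)"
    by (simp add: geometric_fps_def fps_inverse_power del: power_Suc)
  also have "fps_nth \<dots> n = real ((n + k) choose k)"
    by (subst one_minus_const_fps_X_neg_power') (simp_all add: add.commute binomial_symmetric[of k])
  finally show ?thesis .
qed

lemma geometric_fps_1_power_nth_ge:
  "((real n + 1) / real (Suc k)) ^ Suc k \<le> fps_nth (geometric_fps 1 ^ (k + 2)) n"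
proof -
  have "((real n + 1) / real (Suc k)) ^ Suc k \<le> (real (n + Suc k) / real (Suc k)) ^ Suc k"
    by (intro power_mono divide_right_mono) auto
  also have "\<dots> \<le> real ((n + Suc k) choose Suc k)"
    by (rule binomial_ge_n_over_k_pow_k) simp
  also have "\<dots> = fps_nth (geometric_fps 1 ^ (k + 2)) n"
    unfolding add_2_eq_Suc' by (rule geometric_fps_1_power_nth[symmetric])
  finally show ?thesis .
qed

text \<open>
  The index \<open>k\<close> is the exponent of the error term. The pole at 1 has order \<open>k + 2\<close>, so that the
  coefficients of the main term are of order \<open>n\<^bsup>k + 1\<^esup>\<close>.
\<close>
definition dominant_pole :: "nat \<Rightarrow> real \<Rightarrow> real fps \<Rightarrow> bool" where
  "dominant_pole k c f \<longleftrightarrow> poly_bounded k (f - fps_const c * geometric_fps 1 ^ (k + 2))"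

lemma dominant_pole_0_iff: "dominant_pole k 0 f \<longleftrightarrow> poly_bounded k f"
  by (simp add: dominant_pole_def)

lemma dominant_pole_add:
  assumes "dominant_pole k c f" "dominant_pole k d g"
  shows "dominant_pole k (c + d) (f + g)"
  using poly_bounded_add[OF assms[unfolded dominant_pole_def]]
  unfolding dominant_pole_def by (simp add: algebra_simps flip: fps_const_add)

lemma dominant_pole_const_mult:
  assumes "dominant_pole k c f"
  shows "dominant_pole k (d * c) (fps_const d * f)"
  using poly_bounded_const_mult[OF assms[unfolded dominant_pole_def], of d]
  unfolding dominant_pole_def by (simp add: algebra_simps flip: fps_const_mult)

lemma dominant_pole_diff:
  assumes "dominant_pole k c f" "dominant_pole k d g"
  shows "dominant_pole k (c - d) (f - g)"
  using dominant_pole_add[OF assms(1) dominant_pole_const_mult[OF assms(2), of "-1"]]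
  by (simp flip: fps_const_neg)

lemma dominant_pole_X_mult:
  assumes "dominant_pole k c f"
  shows "dominant_pole k c (fps_X * f)"
proof -
  let ?G = "geometric_fps 1"
  have "fps_X * f - fps_const c * ?G ^ (k + 2) =
      fps_X * (f - fps_const c * ?G ^ (k + 2)) - fps_const c * (((1 - fps_X) * ?G) * ?G ^ Suc k)"
    by (simp add: algebra_simps del: One_nat_def)
  also have "\<dots> = fps_X * (f - fps_const c * ?G ^ (k + 2)) - fps_const c * ?G ^ Suc k"
    by (simp only: one_minus_X_mult_geometric_fps_1 mult_1)
  finally have "fps_X * f - fps_const c * ?G ^ (k + 2) = \<dots>" .
  moreover have "poly_bounded k \<dots>"
    by (intro poly_bounded_diff poly_bounded_X_mult poly_bounded_const_mult
        poly_bounded_geometric_fps_power assms[unfolded dominant_pole_def]) simp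
  ultimately show ?thesis
    by (simp add: dominant_pole_def)
qed

lemma dominant_pole_fps_of_poly_mult:
  assumes "dominant_pole k c f"
  shows "dominant_pole k (poly p 1 * c) (fps_of_poly p * f)"
proof (induction p)
  case 0
  show ?case by (simp add: dominant_pole_0_iff poly_bounded_def exI[of _ 0])
next
  case (pCons a p)
  have "dominant_pole k (a * c + poly p 1 * c) (fps_const a * f + fps_X * (fps_of_poly p * f))"
    by (intro dominant_pole_add dominant_pole_const_mult dominant_pole_X_mult assms pCons.IH)
  then show ?case
    by (simp add: fps_of_poly_pCons algebra_simps)
qed

lemma poly_bounded_fps_of_poly_mult:
  assumes "poly_bounded k f"
  shows "poly_bounded k (fps_of_poly p * f)"
  using dominant_pole_fps_of_poly_mult[of k 0 f p] assms by (simp add: dominant_pole_0_iff)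

text \<open>
  The factor \<open>1 - q\<close> reduces the main term of \<open>f\<close> to \<open>O(n\<^sup>k)\<close> and that of \<open>g\<close> to \<open>O(n\<^sup>l)\<close>. This puts
  the mixed products on the same scale \<open>O(n\<^bsup>k + l + 1\<^esup>)\<close> as the product of the two error terms.
\<close>
lemma dominant_pole_one_minus_X_mult:
  assumes "dominant_pole k c f" "dominant_pole l d g"
  shows "dominant_pole (k + l + 1) (c * d) ((1 - fps_X) * f * g)"
proof -
  let ?G = "geometric_fps 1"
  define P Q where "P = ?G ^ Suc k" and "Q = ?G ^ Suc l"
  define A B where "A = f - fps_const c * ?G ^ (k + 2)" and "B = g - fps_const d * ?G ^ (l + 2)"
  have f: "f = fps_const c * (?G * P) + A" and g: "g = fps_const d * (?G * Q) + B"
    by (simp_all add: A_def B_def P_def Q_def)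
  have main_term:
    "fps_const (c * d) * ?G ^ (k + l + 1 + 2) = fps_const c * fps_const d * (?G * (P * Q))"
    by (simp add: P_def Q_def power_add mult_ac)
  have "(1 - fps_X) * f * g =
      ((1 - fps_X) * ?G) * (fps_const c * fps_const d * (?G * (P * Q)) + fps_const c * (P * B)
        + fps_const d * (A * Q)) + (A * B - fps_X * (A * B))"
    unfolding f g by algebra
  then have remainder: "(1 - fps_X) * f * g - fps_const (c * d) * ?G ^ (k + l + 1 + 2) =
      fps_const c * (P * B) + fps_const d * (A * Q) + (A * B - fps_X * (A * B))"
    unfolding one_minus_X_mult_geometric_fps_1 main_term by algebra
  have "poly_bounded k A" "poly_bounded l B"
    using assms unfolding dominant_pole_def A_def B_def by blast+
  moreover have "poly_bounded k P" "poly_bounded l Q"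
    unfolding P_def Q_def by (intro poly_bounded_geometric_fps_power; simp)+
  ultimately show ?thesis
    unfolding dominant_pole_def remainder
    by (intro poly_bounded_add poly_bounded_diff poly_bounded_const_mult poly_bounded_mult
        poly_bounded_X_mult)
qed

lemma dominant_pole_at_top:
  assumes "dominant_pole k c f" "c > 0"
  shows "filterlim (fps_nth f) at_top sequentially"
proof -
  let ?main = "\<lambda>n. fps_nth (geometric_fps 1 ^ (k + 2)) n"
  obtain C where C: "\<And>n. \<bar>fps_nth f n - c * ?main n\<bar> \<le> C * (real n + 1) ^ k"
    using assms(1) unfolding dominant_pole_def poly_bounded_def fps_sub_nth fps_mult_left_const_nth
    by blast
  define d where "d = c / real (Suc k) ^ Suc k"
  have "d > 0"
    using assms(2) by (simp add: d_def)
  have lower: "(real n + 1) ^ k * (d * (real n + 1) - C) \<le> fps_nth f n" for n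
  proof -
    have "d * (real n + 1) ^ Suc k = c * ((real n + 1) / real (Suc k)) ^ Suc k"
      by (simp add: d_def power_divide)
    also have "\<dots> \<le> c * ?main n"
      using assms(2) by (intro mult_left_mono geometric_fps_1_power_nth_ge) simp
    finally show ?thesis
      using C[of n] by (simp add: algebra_simps abs_le_iff)
  qed
  have "filterlim (\<lambda>n. (d - C) + d * real n) at_top sequentially"
    using \<open>d > 0\<close>
    by (intro filterlim_tendsto_add_at_top[OF tendsto_const]
        filterlim_tendsto_pos_mult_at_top[OF tendsto_const] filterlim_real_sequentially)
  then have lim: "filterlim (\<lambda>n. d * (real n + 1) - C) at_top sequentially"
    by (simp add: algebra_simps)
  then have "\<forall>\<^sub>F n in sequentially. d * (real n + 1) - C \<ge> 0"
    unfolding filterlim_at_top by blast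
  then have "\<forall>\<^sub>F n in sequentially. d * (real n + 1) - C \<le> fps_nth f n"
  proof eventually_elim
    case (elim n)
    then have "d * (real n + 1) - C \<le> (real n + 1) ^ k * (d * (real n + 1) - C)"
      using mult_right_mono[OF one_le_power[of "real n + 1" k]] by simp
    then show ?case using lower[of n] by (rule order_trans)
  qed
  with lim show ?thesis
    by (rule filterlim_at_top_mono)
qed

definition geometric_sum_poly :: "nat \<Rightarrow> nat \<Rightarrow> real poly" where
  "geometric_sum_poly a m = (\<Sum>i<m. monom 1 (a * i))"

lemma poly_geometric_sum_poly_1: "poly (geometric_sum_poly a m) 1 = real m"
  by (simp add: geometric_sum_poly_def poly_sum poly_monom)

lemma one_minus_X_power_mult_geometric_sum_poly:
  "(1 - fps_X ^ a) * fps_of_poly (geometric_sum_poly a m) = 1 - fps_X ^ (a * m)"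
  by (simp add: geometric_sum_poly_def fps_of_poly_sum fps_of_poly_monom' power_mult
      one_diff_power_eq[of "fps_X ^ a" m])

lemma one_minus_X_mult_geometric_sum_poly:
  "(1 - fps_X) * fps_of_poly (geometric_sum_poly 1 m) = 1 - fps_X ^ m"
  using one_minus_X_power_mult_geometric_sum_poly[of 1 m] by (simp only: power_one_right mult_1)

lemma dominant_pole_geometric_fps_1_mult:
  assumes "a > 0"
  shows "dominant_pole 0 (1 / real a) (geometric_fps 1 * geometric_fps a)"
proof -
  let ?G = "geometric_fps 1" and ?P = "geometric_fps a"
  let ?S = "fps_of_poly (geometric_sum_poly 1 a)"
  have "?G = ?G * ((1 - fps_X ^ a) * ?P)"
    by (simp only: one_minus_X_power_mult_geometric_fps[OF assms] mult_1_right)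
  also have "\<dots> = ((1 - fps_X) * ?G) * (?S * ?P)"
    unfolding one_minus_X_mult_geometric_sum_poly[of a, symmetric] by (simp only: mult_ac)
  finally have sum_mult_geometric: "?G = ?S * ?P"
    by (simp only: one_minus_X_mult_geometric_fps_1 mult_1)
  define p where "p = [:1:] - smult (1 / real a) (geometric_sum_poly 1 a)"
  have "poly p 1 = 0"
    using assms by (simp add: p_def poly_geometric_sum_poly_1)
  then obtain q where q: "p = [:-1, 1:] * q"
    by (auto simp: poly_eq_0_iff_dvd)
  have "?G * ?P - fps_const (1 / real a) * ?G ^ 2 =
      ?G * ?P - fps_const (1 / real a) * (?G * (?S * ?P))"
    by (simp only: power2_eq_square flip: sum_mult_geometric)
  also have "\<dots> = fps_of_poly p * (?G * ?P)"
    unfolding p_def fps_of_poly_diff fps_of_poly_smult fps_of_poly_1' by algebra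
  also have "\<dots> = - (((1 - fps_X) * ?G) * (fps_of_poly q * ?P))"
    unfolding q fps_of_poly_mult fps_of_poly_linear
    by (simp add: algebra_simps flip: fps_const_neg)
  finally have "?G * ?P - fps_const (1 / real a) * ?G ^ 2 = fps_of_poly (- q) * ?P"
    by (simp only: one_minus_X_mult_geometric_fps_1 mult_1 fps_of_poly_uminus minus_mult_left)
  then show ?thesis
    unfolding dominant_pole_def add_0 using assms
    by (simp only: poly_bounded_fps_of_poly_mult poly_bounded_geometric_fps)
qed

lemma dominant_pole_geometric_fps_mult_coprime:
  assumes "coprime a b" "a > 0" "b > 0"
  shows "dominant_pole 0 (1 / (real a * real b)) (geometric_fps a * geometric_fps b)"
proof -
  let ?G = "geometric_fps 1" and ?A = "geometric_fps a" and ?B = "geometric_fps b"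
  obtain x y where xy: "a * x = b * y + 1"
    using bezout_nat[of a b] assms by auto
  define U where "U = geometric_sum_poly a x"
  define V where "V = [:0, 1:] * geometric_sum_poly b y"
  have "(1 - fps_X ^ a) * fps_of_poly U = 1 - fps_X * fps_X ^ (b * y)"
    by (simp add: U_def one_minus_X_power_mult_geometric_sum_poly xy)
  moreover have "(1 - fps_X ^ b) * fps_of_poly V = fps_X * (1 - fps_X ^ (b * y))"
    unfolding V_def fps_of_poly_mult fps_of_poly_fps_X mult.left_commute[of "1 - fps_X ^ b"]
    by (simp only: one_minus_X_power_mult_geometric_sum_poly)
  ultimately have "(1 - fps_X ^ a) * fps_of_poly U - (1 - fps_X ^ b) * fps_of_poly V = 1 - fps_X"
    by (simp add: algebra_simps)
  note bezout = this[symmetric]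
  have "?A * ?B = ((1 - fps_X) * ?G) * (?A * ?B)"
    by (simp only: one_minus_X_mult_geometric_fps_1 mult_1)
  also have "\<dots> = fps_of_poly U * (?G * ?B) * ((1 - fps_X ^ a) * ?A) -
      fps_of_poly V * (?G * ?A) * ((1 - fps_X ^ b) * ?B)"
    unfolding bezout by (simp only: left_diff_distrib right_diff_distrib mult_ac)
  finally have "?A * ?B = fps_of_poly U * (?G * ?B) - fps_of_poly V * (?G * ?A)"
    using assms by (simp only: one_minus_X_power_mult_geometric_fps mult_1_right)
  moreover have "dominant_pole 0 (poly U 1 * (1 / real b) - poly V 1 * (1 / real a)) \<dots>"
    using assms
    by (intro dominant_pole_diff dominant_pole_fps_of_poly_mult dominant_pole_geometric_fps_1_mult)
  moreover have "poly U 1 * (1 / real b) - poly V 1 * (1 / real a) = 1 / (real a * real b)"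
  proof -
    have "real a * real x = real b * real y + 1"
      using xy by (simp flip: of_nat_mult)
    then show ?thesis
      using assms by (simp add: U_def V_def poly_geometric_sum_poly_1 field_simps)
  qed
  ultimately show ?thesis by simp
qed

lemma filterlim_fps_mult_at_top:
  fixes f h :: "real fps"
  assumes lim: "filterlim (fps_nth f) at_top sequentially"
    and h: "poly_bounded 0 h" "\<And>n. fps_nth h n \<ge> 0" "fps_nth h 0 > 0"
  shows "filterlim (fps_nth (f * h)) at_top sequentially"
proof -
  obtain B where B: "B \<ge> 0" "\<And>n. fps_nth h n \<le> B"
    using h(1) by (auto simp: poly_bounded_def abs_le_iff)
  have "\<forall>\<^sub>F n in sequentially. fps_nth f n \<ge> 0"
    using lim by (simp add: filterlim_at_top)
  then obtain N where N: "\<And>n. n \<ge> N \<Longrightarrow> fps_nth f n \<ge> 0"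
    by (auto simp: eventually_at_top_linorder)
  define S where "S = (\<Sum>i<N. \<bar>fps_nth f i\<bar>)"
  have lower: "- (S * B) + fps_nth f n * fps_nth h 0 \<le> fps_nth (f * h) n" if "n \<ge> N" for n
  proof -
    have "- (S * B) = (\<Sum>i<N. - \<bar>fps_nth f i\<bar> * B)"
      by (simp add: S_def sum_negf sum_distrib_right)
    also have "\<dots> \<le> (\<Sum>i<N. fps_nth f i * fps_nth h (n - i))"
    proof (rule sum_mono)
      fix i
      have "\<bar>fps_nth f i\<bar> * fps_nth h (n - i) \<le> \<bar>fps_nth f i\<bar> * B"
        by (intro mult_left_mono B) auto
      moreover have "- \<bar>fps_nth f i\<bar> * fps_nth h (n - i) \<le> fps_nth f i * fps_nth h (n - i)"
        by (intro mult_right_mono h) auto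
      ultimately show "- \<bar>fps_nth f i\<bar> * B \<le> fps_nth f i * fps_nth h (n - i)" by simp
    qed
    also have "\<dots> \<le> (\<Sum>i<n. fps_nth f i * fps_nth h (n - i))"
      using that N h(2) by (intro sum_mono2) auto
    finally show ?thesis
      by (simp add: fps_mult_nth atLeast0AtMost flip: lessThan_Suc_atMost)
  qed
  have "filterlim (\<lambda>n. - (S * B) + fps_nth f n * fps_nth h 0) at_top sequentially"
    by (intro filterlim_tendsto_add_at_top[OF tendsto_const]
        filterlim_at_top_mult_tendsto_pos[OF tendsto_const h(3) lim])
  then show ?thesis
    by (rule filterlim_at_top_mono) (use lower in \<open>auto simp: eventually_at_top_linorder\<close>)
qed

lemma Hstar_eq_prod_geometric_fps:
  assumes "s > 0"
  shows "Hstar L s r k1 k2 =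
    (fps_X ^ r * (1 - fps_X ^ k1) - (1 - fps_X ^ k2)) * (\<Prod>i<L + 1. geometric_fps (s + i))"
proof -
  have "fps_nth (qpochhammer (fps_X ^ s) fps_X n :: real fps) 0 = 1" for n
    using assms by (induction n) (simp_all add: qpochhammer_def)
  then show ?thesis
    unfolding Hstar_def
    by (simp add: fps_divide_unit qpochhammer_def inverse_prod_fps geometric_fps_def power_add
        del: prod.lessThan_Suc)
qed

lemma Hstar_Suc:
  assumes "s > 0"
  shows "Hstar (Suc L) s r k1 k2 = Hstar L s r k1 k2 * geometric_fps (s + Suc L)"
  by (simp add: Hstar_eq_prod_geometric_fps[OF assms] mult.assoc)

lemma dominant_pole_Hstar_3:
  assumes "s > 0"
  defines "d \<equiv> real s * real (s + 1) * (real (s + 2) * real (s + 3))"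
  shows "dominant_pole 1 ((real k1 - real k2) / d) (Hstar 3 s r k1 k2)"
proof -
  let ?P = geometric_fps
  define p where "p = monom 1 r * geometric_sum_poly 1 k1 - geometric_sum_poly 1 k2"
  have p_at_1: "poly p 1 = real k1 - real k2"
    by (simp add: p_def poly_monom poly_geometric_sum_poly_1)
  have "fps_X ^ r * (1 - fps_X ^ k1) - (1 - fps_X ^ k2) = (1 - fps_X) * fps_of_poly p"
    unfolding p_def fps_of_poly_diff fps_of_poly_mult fps_of_poly_monom' right_diff_distrib
      mult.left_commute[of "1 - fps_X"] one_minus_X_mult_geometric_sum_poly ..
  then have "Hstar 3 s r k1 k2 =
      fps_of_poly p * ((1 - fps_X) * (?P s * ?P (s + 1)) * (?P (s + 2) * ?P (s + 3)))"
    using assms(1) by (simp add: Hstar_eq_prod_geometric_fps eval_nat_numeral mult_ac)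
  moreover have "dominant_pole (0 + 0 + 1)
      (poly p 1 * (1 / (real s * real (s + 1)) * (1 / (real (s + 2) * real (s + 3))))) \<dots>"
  proof (intro dominant_pole_fps_of_poly_mult dominant_pole_one_minus_X_mult
      dominant_pole_geometric_fps_mult_coprime)
    show "coprime s (s + 1)" "coprime (s + 2) (s + 3)"
      using coprime_Suc_right_nat[of s] coprime_Suc_right_nat[of "s + 2"]
      by (simp_all add: numeral_3_eq_3)
  qed (use assms in auto)
  ultimately show ?thesis
    by (simp add: p_at_1 d_def)
qed

theorem theorem1p2:
  fixes L s r k1 k2 :: nat
  assumes "L \<ge> 3" and "s \<ge> 1" and "r \<ge> 0" and "k1 > k2" and "k2 \<ge> 1"
  shows "eventually_positive (Hstar L s r k1 k2)"
proof -
  have "filterlim (fps_nth (Hstar L s r k1 k2)) at_top sequentially"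
    using \<open>L \<ge> 3\<close>
  proof (induction L rule: dec_induct)
    case base
    show ?case
      using assms by (intro dominant_pole_at_top[OF dominant_pole_Hstar_3]) auto
  next
    case (step L)
    then show ?case
      using assms by (simp add: Hstar_Suc filterlim_fps_mult_at_top poly_bounded_geometric_fps
          geometric_fps_nth)
  qed
  then have "\<forall>\<^sub>F n in sequentially. fps_nth (Hstar L s r k1 k2) n > 0"
    by (simp add: filterlim_at_top_dense)
  then show ?thesis
    unfolding eventually_positive_def by (simp add: eventually_at_top_dense)
qed

end
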